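(* Let $C\in[C_-,C_+]$, $T>0$, and consider one coupled mode with initial data $U_0=(u_0,q_0)^T$ such that $m_0=q_0+a\sigma u_0$ is independent of $\delta$ and nonzero ($u_0$ being independent of $\delta$). Then, as $\delta\to0$, the fast macroscopic amplitude is $\beta_f=O(\delta)$, but the fast flux amplitude is $\frac{\lambda_f}{\sigma}\beta_f=O(1)$. Generically, namely if there is $\kappa>0$ with $R(-1/\kappa)\ne e^{-1/\kappa}$, $$\sup_{0<\delta\le\delta_0}\ \max_{0\le n\Delta t\le T}\|U^n-U(t_n)\|\not\to0\qquad\text{as }\Delta t\to0,$$ whereas $$\sup_{0<\delta\le\delta_0}\ \max_{0\le n\Delta t\le T}|u^n-u(t_n)|\le K\Delta t$$ with $K$ independent of $\Delta t$.
   Context: Fix $a>0$, $\sigma>0$ and $\delta_0>0$ with $4a\delta_0\sigma^2<1$. For $0<\delta\le\delta_0$ the coupled mode is $U_t=B_\delta U$, $U=(u,q)^T$, where $$B_\delta=\begin{bmatrix}0&\sigma\\-a\sigma/\delta&-1/\delta\end{bmatrix},\qquad\lambda_s=\frac{-1+\sqrt{1-4a\delta\sigma^2}}{2\delta},\quad\lambda_f=\frac{-1-\sqrt{1-4a\delta\sigma^2}}{2\delta}$$ are its slow and fast eigenvalues, with eigenvectors $v_s=(1,\lambda_s/\sigma)^T$, $v_f=(1,\lambda_f/\sigma)^T$. Initial data are decomposed as $U_0=\beta_sv_s+\beta_fv_f$. The exact solution is $U(t)=(u(t),q(t))^T=e^{tB_\delta}U_0$ and the numerical solution is $U^n=(u^n,q^n)^T=R(\Delta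 tB_\delta)^nU_0$, $t_n=n\Delta t$. Set $C_\pm=\frac{25\pm\sqrt{105}}{780}$, $a_0=\frac16+\frac72C$, $a_1=\frac23-10C$, $a_2=\frac16+\frac{13}2C$, $H(z)=\frac{1+z/4+z^2/48}{1-z/4+z^2/48}$ and $R(z)=\frac{1+a_0z+Cz^2+(a_1z-Cz^2)H(z)}{1-a_2z+\frac32Cz^2}$; $R(M)$ is the rational function of the matrix $M$. *)

theory Defs
  imports "HOL-Analysis.Analysis" "HOL-Library.Landau_Symbols"
begin

definition B_mat :: "real \<Rightarrow> real \<Rightarrow> real \<Rightarrow> real^2^2" where
  "B_mat a \<sigma> \<delta> = vector [vector [0, \<sigma>], vector [- a * \<sigma> / \<delta>, - 1 / \<delta>]]"

definition lambda_s :: "real \<Rightarrow> real \<Rightarrow> real \<Rightarrow> real" where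
  "lambda_s a \<sigma> \<delta> = (- 1 + sqrt (1 - 4 * a * \<delta> * \<sigma>\<^sup>2)) / (2 * \<delta>)"

definition lambda_f :: "real \<Rightarrow> real \<Rightarrow> real \<Rightarrow> real" where
  "lambda_f a \<sigma> \<delta> = (- 1 - sqrt (1 - 4 * a * \<delta> * \<sigma>\<^sup>2)) / (2 * \<delta>)"

definition v_s :: "real \<Rightarrow> real \<Rightarrow> real \<Rightarrow> real^2" where
  "v_s a \<sigma> \<delta> = vector [1, lambda_s a \<sigma> \<delta> / \<sigma>]"

definition v_f :: "real \<Rightarrow> real \<Rightarrow> real \<Rightarrow> real^2" where
  "v_f a \<sigma> \<delta> = vector [1, lambda_f a \<sigma> \<delta> / \<sigma>]"

text \<open>On \<^typ>\<open>real^2^2\<close> the class operation \<open>*\<close> is componentwise, so the overloaded \<open>^\<close>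
  is not the matrix power and \<^const>\<open>exp\<close> is not available; powers and the
  exponential are therefore built from the matrix product \<open>**\<close>.\<close>

primrec mat_pow :: "real^'n^'n \<Rightarrow> nat \<Rightarrow> real^'n^'n" where
  "mat_pow M 0 = mat 1"
| "mat_pow M (Suc k) = M ** mat_pow M k"

definition mat_exp :: "real^'n^'n \<Rightarrow> real^'n^'n" where
  "mat_exp M = (\<Sum>k. (1 / fact k) *\<^sub>R mat_pow M k)"

definition C_minus :: real where "C_minus = (25 - sqrt 105) / 780"
definition C_plus :: real where "C_plus = (25 + sqrt 105) / 780"

definition a0_coeff :: "real \<Rightarrow> real" where "a0_coeff C = 1/6 + 7/2 * C"
definition a1_coeff :: "real \<Rightarrow> real" where "a1_coeff C = 2/3 - 10 * C"
definition a2_coeff :: "real \<Rightarrow> real" where "a2_coeff C = 1/6 + 13/2 * C"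

definition H_fun :: "real \<Rightarrow> real" where
  "H_fun z = (1 + z/4 + z\<^sup>2/48) / (1 - z/4 + z\<^sup>2/48)"

definition R_fun :: "real \<Rightarrow> real \<Rightarrow> real" where
  "R_fun C z =
     (1 + a0_coeff C * z + C * z\<^sup>2 + (a1_coeff C * z - C * z\<^sup>2) * H_fun z)
     / (1 - a2_coeff C * z + 3/2 * C * z\<^sup>2)"

text \<open>The rational functions above evaluated at a matrix. All factors are rational functions
  of the same matrix and commute, so the side on which one divides is immaterial. The value is
  meaningful when the denominators are invertible, as they are at \<open>\<Delta>t B\<close>, whose eigenvalues
  are negative.\<close>

definition H_mat :: "real^'n^'n \<Rightarrow> real^'n^'n" where
  "H_mat M =
     (mat 1 + (1/4) *\<^sub>R M + (1/48) *\<^sub>R (M ** M))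
     ** matrix_inv (mat 1 - (1/4) *\<^sub>R M + (1/48) *\<^sub>R (M ** M))"

definition R_mat :: "real \<Rightarrow> real^'n^'n \<Rightarrow> real^'n^'n" where
  "R_mat C M =
     (mat 1 + a0_coeff C *\<^sub>R M + C *\<^sub>R (M ** M)
       + (a1_coeff C *\<^sub>R M - C *\<^sub>R (M ** M)) ** H_mat M)
     ** matrix_inv (mat 1 - a2_coeff C *\<^sub>R M + (3/2 * C) *\<^sub>R (M ** M))"

definition U_exact :: "real \<Rightarrow> real \<Rightarrow> real \<Rightarrow> real^2 \<Rightarrow> real \<Rightarrow> real^2" where
  "U_exact a \<sigma> \<delta> U0 t = mat_exp (t *\<^sub>R B_mat a \<sigma> \<delta>) *v U0"

definition U_num :: "real \<Rightarrow> real \<Rightarrow> real \<Rightarrow> real \<Rightarrow> real^2 \<Rightarrow> real \<Rightarrow> nat \<Rightarrow> real^2" where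
  "U_num C a \<sigma> \<delta> U0 \<Delta>t n = mat_pow (R_mat C (\<Delta>t *\<^sub>R B_mat a \<sigma> \<delta>)) n *v U0"

text \<open>Uniform errors over \<open>0 < \<delta> \<le> \<delta>\<^sub>0\<close> and \<open>0 \<le> n \<Delta>t \<le> T\<close>, meant for \<open>\<Delta>t > 0\<close>. The supremum
  over \<open>\<delta>\<close> is taken in \<^typ>\<open>ereal\<close> because its finiteness is not known a priori.\<close>

definition full_error ::
  "real \<Rightarrow> real \<Rightarrow> real \<Rightarrow> real \<Rightarrow> real \<Rightarrow> real^2 \<Rightarrow> real \<Rightarrow> ereal" where
  "full_error C a \<sigma> \<delta>0 T U0 \<Delta>t =
     (SUP \<delta>\<in>{0<..\<delta>0}.
        ereal (Max ((\<lambda>n. norm (U_num C a \<sigma> \<delta> U0 \<Delta>t n - U_exact a \<sigma> \<delta> U0 (real n * \<Delta>t)))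
                    ` {n. real n * \<Delta>t \<le> T})))"

definition u_error ::
  "real \<Rightarrow> real \<Rightarrow> real \<Rightarrow> real \<Rightarrow> real \<Rightarrow> real^2 \<Rightarrow> real \<Rightarrow> ereal" where
  "u_error C a \<sigma> \<delta>0 T U0 \<Delta>t =
     (SUP \<delta>\<in>{0<..\<delta>0}.
        ereal (Max ((\<lambda>n. \<bar>U_num C a \<sigma> \<delta> U0 \<Delta>t n $ 1 - U_exact a \<sigma> \<delta> U0 (real n * \<Delta>t) $ 1\<bar>)
                    ` {n. real n * \<Delta>t \<le> T})))"

lemma B_mat_eigenvectors:
  assumes "\<sigma> > 0" "\<delta> > 0" "4 * a * \<delta> * \<sigma>\<^sup>2 < 1"
  shows "B_mat a \<sigma> \<delta> *v v_s a \<sigma> \<delta> = lambda_s a \<sigma> \<delta> *\<^sub>R v_s a \<sigma> \<delta>"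
    and "B_mat a \<sigma> \<delta> *v v_f a \<sigma> \<delta> = lambda_f a \<sigma> \<delta> *\<^sub>R v_f a \<sigma> \<delta>"
proof -
  define s where "s = sqrt (1 - 4 * a * \<delta> * \<sigma>\<^sup>2)"
  have s: "s * s = 1 - 4 * a * \<delta> * \<sigma>\<^sup>2"
    using assms by (simp add: s_def)
  have char: "- a * \<sigma> / \<delta> - l / (\<delta> * \<sigma>) = l * (l / \<sigma>)"
    if "l = (- 1 + e * s) / (2 * \<delta>)" "e * e = 1" for e l :: real
  proof -
    have "2 * \<delta> * l + 1 = e * s"
      using that(1) assms by simp
    then have "(2 * \<delta> * l + 1) * (2 * \<delta> * l + 1) = (e * e) * (s * s)"
      by simp
    then have "(2 * \<delta> * l + 1) * (2 * \<delta> * l + 1) = 1 - 4 * a * \<delta> * \<sigma>\<^sup>2"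
      unfolding that(2) s by simp
    then have "4 * \<delta> * (\<delta> * l * l + l + a * \<sigma>\<^sup>2) = 0"
      by (simp add: algebra_simps)
    then have "\<delta> * l * l + l + a * \<sigma>\<^sup>2 = 0"
      using assms by simp
    then have "- a * \<sigma>\<^sup>2 - l = \<delta> * l * l"
      by simp
    moreover have "- a * \<sigma> / \<delta> - l / (\<delta> * \<sigma>) = (- a * \<sigma>\<^sup>2 - l) / (\<delta> * \<sigma>)"
      using assms by (simp add: diff_divide_distrib power2_eq_square)
    ultimately show ?thesis
      using assms by simp
  qed
  have "- a * \<sigma> / \<delta> - lambda_s a \<sigma> \<delta> / (\<delta> * \<sigma>)
      = lambda_s a \<sigma> \<delta> * (lambda_s a \<sigma> \<delta> / \<sigma>)"
    by (rule char[of _ "1"]) (simp_all add: lambda_s_def s_def)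
  then show "B_mat a \<sigma> \<delta> *v v_s a \<sigma> \<delta> = lambda_s a \<sigma> \<delta> *\<^sub>R v_s a \<sigma> \<delta>"
    using assms
    by (simp add: vec_eq_iff forall_2 matrix_vector_mult_def sum_2 B_mat_def v_s_def ac_simps)
  have "- a * \<sigma> / \<delta> - lambda_f a \<sigma> \<delta> / (\<delta> * \<sigma>)
      = lambda_f a \<sigma> \<delta> * (lambda_f a \<sigma> \<delta> / \<sigma>)"
    by (rule char[of _ "- 1"]) (simp_all add: lambda_f_def s_def)
  then show "B_mat a \<sigma> \<delta> *v v_f a \<sigma> \<delta> = lambda_f a \<sigma> \<delta> *\<^sub>R v_f a \<sigma> \<delta>"
    using assms
    by (simp add: vec_eq_iff forall_2 matrix_vector_mult_def sum_2 B_mat_def v_f_def ac_simps)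
qed

lemma eigen_decomposition:
  fixes U0 :: "real^2"
  assumes "\<sigma> > 0" "\<delta> > 0" "4 * a * \<delta> * \<sigma>\<^sup>2 < 1"
  shows "\<exists>!\<beta>. U0 = fst \<beta> *\<^sub>R v_s a \<sigma> \<delta> + snd \<beta> *\<^sub>R v_f a \<sigma> \<delta>"
proof -
  define p where "p = lambda_s a \<sigma> \<delta> / \<sigma>"
  define q where "q = lambda_f a \<sigma> \<delta> / \<sigma>"
  have "q < p"
    using assms by (simp add: p_def q_def lambda_s_def lambda_f_def divide_strict_right_mono)
  have dec: "U0 = x *\<^sub>R v_s a \<sigma> \<delta> + y *\<^sub>R v_f a \<sigma> \<delta> \<longleftrightarrow> U0 $ 1 = x + y \<and> U0 $ 2 = x * p + y * q" for x y
    by (simp add: vec_eq_iff forall_2 v_s_def v_f_def p_def q_def)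
  have sol: "U0 $ 1 = x + y \<and> U0 $ 2 = x * p + y * q \<longleftrightarrow>
      x = (U0 $ 2 - q * U0 $ 1) / (p - q) \<and> y = (p * U0 $ 1 - U0 $ 2) / (p - q)" (is "?L = ?R") for x y
  proof
    assume ?L
    then show ?R using \<open>q < p\<close> by (auto simp: nonzero_eq_divide_eq algebra_simps)
  next
    assume R: ?R
    have "x + y = ((p - q) * U0 $ 1) / (p - q)"
      using R by (simp add: add_divide_distrib[symmetric] algebra_simps)
    moreover have "x * p + y * q = ((p - q) * U0 $ 2) / (p - q)"
      using R by (simp add: add_divide_distrib[symmetric] algebra_simps)
    ultimately show ?L using \<open>q < p\<close> by simp
  qed
  show ?thesis
    unfolding dec sol by (auto intro!: ex1I[of _ "(_, _)"] simp: prod_eq_iff)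
qed

end

theory Submission
  imports Defs
begin

text \<open>On the negative half axis \<open>0 \<le> R z - (1 + z) \<le> z\<^sup>2\<close> and \<open>\<bar>R z\<bar> \<le> 1\<close>, because after
  clearing denominators all polynomials in \<open>-z\<close> have nonnegative coefficients. This gives
  \<open>\<bar>R z ^ n - exp (n z)\<bar> \<le> 4 \<bar>z\<bar>\<close> for all \<open>n\<close> and all \<open>z \<le> 0\<close>: for small \<open>\<bar>z\<bar>\<close> both
  \<open>\<bar>R z\<bar>\<close> and \<open>exp z\<close> are at most \<open>exp (z / 2)\<close>, and this damping compensates the \<open>n\<close>
  accumulated local errors of size \<open>z\<^sup>2\<close>. Hence an eigencomponent of amplitude \<open>\<beta>\<close> and rate
  \<open>\<lambda>\<close> contributes at most \<open>4 \<bar>\<beta> \<lambda>\<bar> \<Delta>t\<close>, where \<open>\<beta> \<lambda>\<close> is bounded uniformly in \<open>\<delta>\<close> for the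
  slow and for the fast mode. In the flux the fast amplitude \<open>\<beta>\<^sub>f \<lambda>\<^sub>f / \<sigma>\<close> tends to \<open>m\<^sub>0\<close>, so that
  the single step \<open>\<Delta>t = -1 / (\<kappa> \<lambda>\<^sub>f)\<close> leaves an error close to
  \<open>\<bar>m\<^sub>0\<bar> \<bar>R (-1/\<kappa>) - exp (-1/\<kappa>)\<bar>\<close>.\<close>

section \<open>The stability function on the negative half axis\<close>

text \<open>The thresholds are those at which \<open>13/2 * C - 1/12\<close> and
  \<open>1/48 - C/8\<close>, coefficients occurring in \<open>R_fun_bounds\<close>, change
  sign.\<close>

lemma C_range:
  assumes "C \<in> {C_minus..C_plus}"
  shows "1/78 \<le> C" "C \<le> 1/6"
proof -
  have "sqrt 105 \<le> 11"
    by (rule real_le_lsqrt) simp_all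
  then show "1/78 \<le> C" "C \<le> 1/6"
    using assms by (auto simp: C_minus_def C_plus_def)
qed

text \<open>\<open>R_num\<close> and \<open>R_den\<close> are what remains of R(-x) once the inner
  fraction \<open>H_fun\<close> is cleared. The quartic terms of the numerator cancel, because z^2
  enters with the opposite coefficients C and -C.\<close>

definition R_num :: "real \<Rightarrow> real \<Rightarrow> real" where
  "R_num C x = 1 + (13/2 * C - 7/12) * x + (7/48 - 27/8 * C) * x^2 + (61/96 * C - 5/288) * x^3"

definition R_den :: "real \<Rightarrow> real \<Rightarrow> real" where
  "R_den C x = (1 + (1/6 + 13/2 * C) * x + 3/2 * C * x^2) * (1 + x/4 + x^2/48)"

lemma H_den_pos: "(0::real) < 1 - z/4 + z^2/48" if "z \<le> 0"
  using that by (intro add_pos_nonneg) auto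

lemma R_fun_den_pos: "0 < 1 - a2_coeff C * z + 3/2 * C * z^2" if "z \<le> 0" "0 \<le> C"
  using that by (intro add_pos_nonneg)
    (auto simp: a2_coeff_def intro: order.strict_trans1[OF mult_nonneg_nonpos])

lemma R_fun_eq:
  assumes "0 \<le> x" "0 \<le> C"
  shows "R_fun C (- x) = R_num C x / R_den C x" and "0 < R_den C x"
proof -
  define h where "h = 1 + x/4 + x^2/48"
  define g where "g = 1 - x/4 + x^2/48"
  define D where "D = 1 + (1/6 + 13/2 * C) * x + 3/2 * C * x^2"
  have h: "0 < h" and D: "0 < D"
    using assms by (auto simp: h_def D_def intro!: add_pos_nonneg mult_nonneg_nonneg)
  then show "0 < R_den C x"
    by (simp add: R_den_def h_def D_def)
  have H: "H_fun (- x) = g / h"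
    by (simp add: H_fun_def g_def h_def)
  have "R_fun C (- x) = (1 - a0_coeff C * x + C * x^2 - (a1_coeff C * x + C * x^2) * (g / h)) / D"
    by (simp add: R_fun_def H D_def a2_coeff_def algebra_simps)
  also have "\<dots> = ((1 - a0_coeff C * x + C * x^2) * h - (a1_coeff C * x + C * x^2) * g) / (D * h)"
    using h D by (simp add: field_simps)
  also have "(1 - a0_coeff C * x + C * x^2) * h - (a1_coeff C * x + C * x^2) * g = R_num C x"
    by (simp add: R_num_def a0_coeff_def a1_coeff_def h_def g_def power2_eq_square power3_eq_cube
        field_simps)
  finally show "R_fun C (- x) = R_num C x / R_den C x"
    by (simp add: R_den_def D_def h_def)
qed

lemma R_fun_bounds:
  assumes x: "0 \<le> x" and C: "1/78 \<le> C" "C \<le> 1/6"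
  shows "\<bar>R_fun C (- x)\<bar> \<le> 1" "1 - x \<le> R_fun C (- x)" "R_fun C (- x) \<le> 1 - x + x^2"
proof -
  have C0: "0 \<le> C" using C by simp
  note R = R_fun_eq[OF x C0]
  have "0 \<le> x + (13/2 * C - 1/12) * x^2 + (1/48 - C/8) * x^3 + C/32 * x^4"
    using assms by (intro add_nonneg_nonneg mult_nonneg_nonneg) auto
  also have "\<dots> = R_den C x - R_num C x"
    by (simp add: R_num_def R_den_def power2_eq_square power3_eq_cube power4_eq_xxxx field_simps)
  finally have 1: "R_num C x \<le> R_den C x" by simp
  have "0 \<le> 2 + (13 * C - 1/6) * x + (5/24 - C/4) * x^2 + (55/48 * C - 1/72) * x^3 + C/32 * x^4"
    using assms by (intro add_nonneg_nonneg mult_nonneg_nonneg) auto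
  also have "\<dots> = R_den C x + R_num C x"
    by (simp add: R_num_def R_den_def power2_eq_square power3_eq_cube power4_eq_xxxx field_simps)
  finally have 2: "- R_den C x \<le> R_num C x" by simp
  show "\<bar>R_fun C (- x)\<bar> \<le> 1"
    using 1 2 R(2) by (simp add: R(1) abs_le_iff field_simps)
  \<comment> \<open>First-order consistency cancels the constant and linear terms of the difference
    below; \<open>E\<close> is the cofactor of \<open>x^2\<close>. The lower bound then needs
    \<open>0 \<le> E\<close>, the upper one \<open>E \<le> R_den C x\<close>.\<close>
  define E where "E = 1/2 + (1/24 + 13/4 * C) * x + (1/288 + 23/48 * C) * x^2 + C/32 * x^3"
  have E: "R_num C x - (1 - x) * R_den C x = x^2 * E"
    by (simp add: E_def R_num_def R_den_def power2_eq_square power3_eq_cube field_simps)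
  have "0 \<le> E"
    using assms unfolding E_def by (intro add_nonneg_nonneg mult_nonneg_nonneg) auto
  then have "0 \<le> x^2 * E" by simp
  then show "1 - x \<le> R_fun C (- x)"
    using E R(2) by (simp add: R(1) field_simps)
  have "0 \<le> 1/2 + (3/8 + 13/4 * C) * x + (17/288 + 127/48 * C) * x^2
      + (1/288 + 23/48 * C) * x^3 + C/32 * x^4"
    using assms by (intro add_nonneg_nonneg mult_nonneg_nonneg) auto
  also have "\<dots> = R_den C x - E"
    by (simp add: E_def R_den_def power2_eq_square power3_eq_cube power4_eq_xxxx field_simps)
  finally have "x^2 * E \<le> x^2 * R_den C x" by (simp add: mult_left_mono)
  then show "R_fun C (- x) \<le> 1 - x + x^2"
    using E R(2) unfolding R(1) pos_divide_le_eq[OF R(2)] by (simp add: algebra_simps)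
qed

text \<open>Telescoping gives n terms with n - 1 factors of size r each. The extra factor
  \<open>r\<close> on the left avoids the exponent n - 1, so n = 0 is no exception.\<close>

lemma abs_power_diff_le:
  fixes a b r :: real
  assumes "\<bar>a\<bar> \<le> r" "\<bar>b\<bar> \<le> r"
  shows "r * \<bar>a ^ n - b ^ n\<bar> \<le> real n * r ^ n * \<bar>a - b\<bar>"
proof (induction n)
  case (Suc n)
  have r: "0 \<le> r" using assms by simp
  have "a ^ Suc n - b ^ Suc n = a * (a ^ n - b ^ n) + (a - b) * b ^ n"
    by (simp add: algebra_simps)
  then have "\<bar>a ^ Suc n - b ^ Suc n\<bar> \<le> \<bar>a\<bar> * \<bar>a ^ n - b ^ n\<bar> + \<bar>a - b\<bar> * \<bar>b\<bar> ^ n"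
    by (metis abs_mult abs_triangle_ineq power_abs)
  also have "\<dots> \<le> r * \<bar>a ^ n - b ^ n\<bar> + \<bar>a - b\<bar> * r ^ n"
    using assms by (intro add_mono mult_mono power_mono) auto
  also have "\<dots> \<le> real n * r ^ n * \<bar>a - b\<bar> + \<bar>a - b\<bar> * r ^ n"
    using Suc by simp
  finally have "\<bar>a ^ Suc n - b ^ Suc n\<bar> \<le> real (Suc n) * r ^ n * \<bar>a - b\<bar>"
    by (simp add: algebra_simps)
  from mult_left_mono[OF this r] show ?case
    by (simp add: algebra_simps)
qed simp

lemma R_fun_power_error:
  assumes z: "z \<le> 0" and C: "1/78 \<le> C" "C \<le> 1/6"
  shows "\<bar>R_fun C z ^ n - exp (real n * z)\<bar> \<le> 4 * \<bar>z\<bar>"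
proof -
  define x where "x = - z"
  have x: "0 \<le> x" and zx: "z = - x" using z by (simp_all add: x_def)
  define a where "a = R_fun C (- x)"
  define b where "b = exp (- x)"
  have bn: "exp (real n * z) = b ^ n"
    by (simp add: b_def zx exp_of_nat_mult[symmetric])
  have b: "0 < b" "b \<le> 1"
    using x by (simp_all add: b_def)
  note a = R_fun_bounds[OF x C, folded a_def]
  have "\<bar>a ^ n - b ^ n\<bar> \<le> 4 * x"
  proof (cases "x \<le> 1/2")
    \<comment> \<open>Both powers lie in [-1,1], so they differ by at most 2 < 4 * x.\<close>
    case False
    have "\<bar>a\<bar> ^ n \<le> 1" "b ^ n \<le> 1" "0 \<le> b ^ n"
      using a b by (auto intro: power_le_one)
    then show ?thesis
      using False by (simp add: power_abs[symmetric] abs_le_iff)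
  next
    case True
    \<comment> \<open>Half the decay rate leaves room for the quadratic term: x \<le> 1/2 gives
      \<open>1 - x + x^2 \<le> 1 - x/2 \<le> r\<close>.\<close>
    define r where "r = exp (- (x / 2))"
    have r0: "0 < r" by (simp add: r_def)
    have sq: "x^2 \<le> x / 2"
      using mult_left_mono[OF True x] by (simp add: power2_eq_square)
    have "a \<le> 1 - x / 2" using a sq by simp
    also have "\<dots> \<le> r"
      using exp_ge_add_one_self[of "- (x/2)"] by (simp add: r_def)
    finally have ar: "\<bar>a\<bar> \<le> r" using a True by simp
    have br: "\<bar>b\<bar> \<le> r" using x by (simp add: b_def r_def)
    \<comment> \<open>Uses (1 + x) * (1 - x + x^2) = 1 + x^3. Then a and b share the interval from 1
      - x to 1 - x + x^2, whence the local error.\<close>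
    have "b \<le> 1 - x + x^2"
    proof -
      have "(1 + x) * b \<le> exp x * b"
        using b exp_ge_add_one_self[of x] by (intro mult_right_mono) auto
      then have "(1 + x) * b \<le> 1"
        by (simp add: b_def exp_minus)
      also have "1 \<le> (1 + x) * (1 - x + x^2)"
        using x by (simp add: algebra_simps power2_eq_square)
      finally show ?thesis using x by (simp add: mult_le_cancel_left)
    qed
    moreover have "1 - x \<le> b"
      using exp_ge_add_one_self[of "- x"] by (simp add: b_def)
    ultimately have ab: "\<bar>a - b\<bar> \<le> x^2" using a by simp
    have half: "1/2 \<le> r"
      using exp_ge_add_one_self[of "- (x/2)"] True by (simp add: r_def)
    \<comment> \<open>This is y * exp (-y) \<le> 1 for y = n * x / 2; it absorbs the factor
      n.\<close>
    have "r ^ n = exp (- (real n * (x / 2)))"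
      by (simp add: r_def exp_of_nat_mult[symmetric])
    moreover have "real n * (x / 2) \<le> exp (real n * (x / 2))"
      using exp_ge_add_one_self[of "real n * (x / 2)"] by linarith
    ultimately have nr: "real n * (x / 2) * r ^ n \<le> 1"
      by (simp add: exp_minus divide_inverse[symmetric])
    \<comment> \<open>The bound reached is 2 * x; dividing by the lower bound 1/2 of r produces the
      constant 4.\<close>
    have "1/2 * \<bar>a ^ n - b ^ n\<bar> \<le> r * \<bar>a ^ n - b ^ n\<bar>"
      using half by (intro mult_right_mono) auto
    also have "\<dots> \<le> real n * r ^ n * \<bar>a - b\<bar>"
      by (rule abs_power_diff_le[OF ar br])
    also have "\<dots> \<le> real n * r ^ n * x^2"
      using ab r0 by (intro mult_left_mono) auto
    also have "\<dots> = (real n * (x / 2) * r ^ n) * (2 * x)"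
      by (simp add: power2_eq_square)
    also have "\<dots> \<le> 2 * x"
      using mult_right_mono[OF nr, of "2 * x"] x by simp
    finally show ?thesis by simp
  qed
  then show ?thesis using z unfolding bn by (simp add: a_def zx)
qed

section \<open>Matrix functions on eigenvectors\<close>

lemma mat_pow_eigen:
  assumes "M *v v = l *\<^sub>R v"
  shows "mat_pow M k *v v = (l ^ k) *\<^sub>R v"
  by (induction k)
    (simp_all add: assms matrix_vector_mul_assoc[symmetric] matrix_vector_mult_scaleR mult.commute)

lemma mat_pow_entry_le:
  fixes M :: "real^'n^'n"
  assumes B: "\<And>i j. \<bar>M $ i $ j\<bar> \<le> B"
  shows "\<bar>mat_pow M k $ i $ j\<bar> \<le> (real CARD('n) * B) ^ k"
proof (induction k arbitrary: i)
  case 0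
  show ?case by (simp add: mat_def)
next
  case (Suc k)
  have B0: "0 \<le> B" using B[of i i] by linarith
  have "\<bar>mat_pow M (Suc k) $ i $ j\<bar> \<le> (\<Sum>l\<in>UNIV. \<bar>M $ i $ l * mat_pow M k $ l $ j\<bar>)"
    by (simp add: matrix_matrix_mult_def sum_abs)
  also have "\<dots> \<le> (\<Sum>l\<in>(UNIV::'n set). B * (real CARD('n) * B) ^ k)"
    unfolding abs_mult by (intro sum_mono mult_mono B Suc) (auto simp: B0)
  finally show ?case by (simp add: algebra_simps)
qed

text \<open>The entries of the powers grow at most geometrically, so the factorials win: the norm is
  at most the sum of the \<open>CARD('n)\<close> squared absolute entries, and the scalar series of
  exp c dominates up to that factor.\<close>

lemma summable_mat_exp:
  fixes M :: "real^'n^'n"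
  shows "summable (\<lambda>k. (1 / fact k) *\<^sub>R mat_pow M k)"
proof -
  define B where "B = Max (range (\<lambda>(i, j). \<bar>M $ i $ j\<bar>))"
  have B: "\<bar>M $ i $ j\<bar> \<le> B" for i j
    unfolding B_def by (rule Max_ge) (auto intro!: image_eqI[of _ _ "(i, j)"])
  define c where "c = real CARD('n) * B"
  have norm_le: "norm A \<le> (\<Sum>i\<in>UNIV. \<Sum>j\<in>UNIV. \<bar>A $ i $ j\<bar>)" for A :: "real^'n^'n"
  proof -
    have "norm A \<le> (\<Sum>i\<in>UNIV. norm (A $ i))"
      unfolding norm_vec_def[of A] by (rule L2_set_le_sum) simp
    also have "\<dots> \<le> (\<Sum>i\<in>UNIV. \<Sum>j\<in>UNIV. \<bar>A $ i $ j\<bar>)"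
      by (intro sum_mono norm_le_l1_cart)
    finally show ?thesis .
  qed
  show ?thesis
  proof (rule summable_comparison_test')
    show "summable (\<lambda>k. (real CARD('n))\<^sup>2 * (inverse (fact k) * c ^ k))"
      by (intro summable_mult summable_exp)
    fix k
    have "norm (mat_pow M k) \<le> (\<Sum>i\<in>(UNIV::'n set). \<Sum>j\<in>(UNIV::'n set). c ^ k)"
      unfolding c_def by (intro order.trans[OF norm_le] sum_mono mat_pow_entry_le B)
    then have "norm (mat_pow M k) \<le> (real CARD('n))\<^sup>2 * c ^ k"
      by (simp add: power2_eq_square)
    from mult_left_mono[OF this, of "inverse (fact k)"]
    show "norm ((1 / fact k) *\<^sub>R mat_pow M k) \<le> (real CARD('n))\<^sup>2 * (inverse (fact k) * c ^ k)"
      by (simp add: field_simps)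
  qed
qed

text \<open>Evaluation at a fixed vector is bounded linear in the matrix, hence passes through the
  convergent series and leaves the scalar exponential series.\<close>

lemma mat_exp_eigen:
  fixes M :: "real^'n^'n"
  assumes "M *v v = l *\<^sub>R v"
  shows "mat_exp M *v v = exp l *\<^sub>R v"
proof -
  have bl: "bounded_linear (\<lambda>A::real^'n^'n. A *v v)"
    by (intro linear_conv_bounded_linear[THEN iffD1] linearI)
      (simp_all add: matrix_vector_mult_add_rdistrib scaleR_matrix_vector_assoc)
  have "mat_exp M *v v = (\<Sum>k. ((1 / fact k) *\<^sub>R mat_pow M k) *v v)"
    unfolding mat_exp_def by (rule bounded_linear.suminf[OF bl summable_mat_exp])
  also have "\<dots> = (\<Sum>k. (l ^ k /\<^sub>R fact k) *\<^sub>R v)"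
    by (simp add: scaleR_matrix_vector_assoc[symmetric] mat_pow_eigen[OF assms] field_simps)
  also have "\<dots> = exp l *\<^sub>R v"
    unfolding exp_def
    by (rule bounded_linear.suminf[OF bounded_linear_scaleR_left summable_exp_generic, symmetric])
  finally show ?thesis .
qed

text \<open>Dividing the two coordinates by the eigenvalues yields a preimage of any vector, and a
  surjective square matrix is invertible.\<close>

lemma invertible_eigenbasis:
  fixes A :: "real^'n^'n"
  assumes "A *v v = \<alpha> *\<^sub>R v" "A *v w = \<beta> *\<^sub>R w" "\<alpha> \<noteq> 0" "\<beta> \<noteq> 0"
    and span: "\<And>x. \<exists>s t. x = s *\<^sub>R v + t *\<^sub>R w"
  shows "invertible A"
proof -
  have "surj ((*v) A)"
    unfolding surj_def
  proof
    fix x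
    obtain s t where "x = s *\<^sub>R v + t *\<^sub>R w" using span by blast
    then have "x = A *v ((s / \<alpha>) *\<^sub>R v + (t / \<beta>) *\<^sub>R w)"
      using assms by (simp add: matrix_vector_right_distrib matrix_vector_mult_scaleR)
    then show "\<exists>y. x = A *v y" by blast
  qed
  then show ?thesis
    by (simp add: invertible_right_inverse matrix_right_invertible_surjective)
qed

lemma matrix_inv_eigen:
  fixes A :: "real^'n^'n"
  assumes "invertible A" "A *v v = \<alpha> *\<^sub>R v" "\<alpha> \<noteq> 0"
  shows "matrix_inv A *v v = (1 / \<alpha>) *\<^sub>R v"
proof -
  have "v = A *v ((1 / \<alpha>) *\<^sub>R v)"
    using assms by (simp add: matrix_vector_mult_scaleR)
  then have "matrix_inv A *v v = (matrix_inv A ** A) *v ((1 / \<alpha>) *\<^sub>R v)"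
    by (metis matrix_vector_mul_assoc)
  \<comment> \<open>\<open>matrix_inv\<close> is a choice operator; invertibility ensures that the
    chosen matrix is a two-sided inverse.\<close>
  then show ?thesis
    using someI_ex[OF assms(1)[unfolded invertible_def]] by (simp add: matrix_inv_def)
qed

lemma quadratic_eigen:
  fixes M :: "real^'n^'n"
  assumes "M *v v = l *\<^sub>R v"
  shows "(mat 1 + b *\<^sub>R M + c *\<^sub>R (M ** M)) *v v = (1 + b * l + c * l^2) *\<^sub>R v"
  by (simp add: matrix_vector_mult_add_rdistrib scaleR_matrix_vector_assoc[symmetric] assms
      matrix_vector_mul_assoc[symmetric] matrix_vector_mult_scaleR algebra_simps power2_eq_square)

text \<open>The companion eigenvector w serves to invert the denominators on the whole space: their
  eigenvalues are positive because l and k are nonpositive. Every factor then acts on v as a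
  scalar.\<close>

lemma R_mat_eigen:
  fixes M :: "real^'n^'n"
  assumes v: "M *v v = l *\<^sub>R v" "l \<le> 0" and w: "M *v w = k *\<^sub>R w" "k \<le> 0"
    and span: "\<And>x. \<exists>s t. x = s *\<^sub>R v + t *\<^sub>R w" and C: "0 \<le> C"
  shows "R_mat C M *v v = R_fun C l *\<^sub>R v"
proof -
  define A where "A = mat 1 - (1/4) *\<^sub>R M + (1/48) *\<^sub>R (M ** M)"
  define D where "D = mat 1 - a2_coeff C *\<^sub>R M + (3/2 * C) *\<^sub>R (M ** M)"
  have A: "A *v y = (1 - m/4 + m^2/48) *\<^sub>R y" if "M *v y = m *\<^sub>R y" for y m
    using quadratic_eigen[OF that, of "- (1/4)" "1/48"] by (simp add: A_def)
  have D: "D *v y = (1 - a2_coeff C * m + 3/2 * C * m^2) *\<^sub>R y" if "M *v y = m *\<^sub>R y" for y m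
    using quadratic_eigen[OF that, of "- a2_coeff C" "3/2 * C"] by (simp add: D_def)
  have "invertible A"
    using H_den_pos v(2) w(2) by (intro invertible_eigenbasis[OF A[OF v(1)] A[OF w(1)] _ _ span]) force+
  then have invA: "matrix_inv A *v v = (1 / (1 - l/4 + l^2/48)) *\<^sub>R v"
    using H_den_pos[OF v(2)] by (intro matrix_inv_eigen A v) auto
  have "invertible D"
    using R_fun_den_pos[OF v(2) C] R_fun_den_pos[OF w(2) C]
    by (intro invertible_eigenbasis[OF D[OF v(1)] D[OF w(1)] _ _ span]) auto
  then have invD: "matrix_inv D *v v = (1 / (1 - a2_coeff C * l + 3/2 * C * l^2)) *\<^sub>R v"
    using R_fun_den_pos[OF v(2) C] by (intro matrix_inv_eigen D v) auto
  have H: "H_mat M *v v = H_fun l *\<^sub>R v"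
    unfolding H_mat_def A_def[symmetric] H_fun_def
    by (simp add: matrix_vector_mul_assoc[symmetric] invA quadratic_eigen[OF v(1)]
        matrix_vector_mult_scaleR)
  have "(mat 1 + a0_coeff C *\<^sub>R M + C *\<^sub>R (M ** M)
       + (a1_coeff C *\<^sub>R M - C *\<^sub>R (M ** M)) ** H_mat M) *v v =
     (1 + a0_coeff C * l + C * l\<^sup>2 + (a1_coeff C * l - C * l\<^sup>2) * H_fun l) *\<^sub>R v"
    by (simp add: matrix_vector_mult_add_rdistrib matrix_vector_mult_diff_rdistrib
        matrix_vector_mul_assoc[symmetric] H
        scaleR_matrix_vector_assoc[symmetric] v(1)
        matrix_vector_mult_scaleR algebra_simps power2_eq_square)
  then show ?thesis
    unfolding R_mat_def D_def[symmetric] R_fun_def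
    by (simp add: matrix_vector_mul_assoc[symmetric] invD matrix_vector_mult_scaleR)
qed

section \<open>The coupled mode\<close>

locale coupled_mode =
  fixes a \<sigma> \<delta>0 :: real
  assumes a_pos: "a > 0" and sigma_pos: "\<sigma> > 0" and delta0_pos: "\<delta>0 > 0"
    and subcritical: "4 * a * \<delta>0 * \<sigma>\<^sup>2 < 1"
begin

text \<open>Root of the scaled discriminant. It is smallest at \<open>\<delta>0\<close>, where it is
  still positive, which gives a lower bound uniform in \<delta>.\<close>

definition disc_root :: "real \<Rightarrow> real" where
  "disc_root \<delta> = sqrt (1 - 4 * a * \<delta> * \<sigma>\<^sup>2)"

lemma disc_root0_pos: "0 < disc_root \<delta>0"
  using subcritical by (simp add: disc_root_def)

lemma disc_root_bounds:
  assumes "0 < \<delta>" "\<delta> \<le> \<delta>0"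
  shows "disc_root \<delta>0 \<le> disc_root \<delta>" "0 < disc_root \<delta>" "disc_root \<delta> \<le> 1"
    and disc_root_sq: "disc_root \<delta> * disc_root \<delta> = 1 - 4 * a * \<delta> * \<sigma>\<^sup>2"
proof -
  have "4 * a * \<delta> * \<sigma>\<^sup>2 \<le> 4 * a * \<delta>0 * \<sigma>\<^sup>2"
    using assms a_pos by (intro mult_right_mono mult_left_mono) auto
  then show "disc_root \<delta>0 \<le> disc_root \<delta>" "disc_root \<delta> * disc_root \<delta> = 1 - 4 * a * \<delta> * \<sigma>\<^sup>2"
    using subcritical by (simp_all add: disc_root_def)
  then show "0 < disc_root \<delta>" using disc_root0_pos by simp
  show "disc_root \<delta> \<le> 1"
    using assms a_pos by (simp add: disc_root_def)
qed

text \<open>Rationalising the numerator removes \<delta> from the denominator; both the uniform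
  bound and the limit of the slow eigenvalue rest on this form.\<close>

lemma lambda_s_eq:
  assumes "0 < \<delta>" "\<delta> \<le> \<delta>0"
  shows "lambda_s a \<sigma> \<delta> = - (2 * a * \<sigma>\<^sup>2 / (1 + disc_root \<delta>))"
proof -
  have "(disc_root \<delta> - 1) * (1 + disc_root \<delta>) = - (4 * a * \<delta> * \<sigma>\<^sup>2)"
    using disc_root_sq[OF assms] by (simp add: algebra_simps)
  then show ?thesis
    using disc_root_bounds[OF assms] assms
    unfolding lambda_s_def disc_root_def[symmetric] by (simp add: field_simps)
qed

lemma lambda_f_eq: "lambda_f a \<sigma> \<delta> = - (1 + disc_root \<delta>) / (2 * \<delta>)"
  by (simp add: lambda_f_def disc_root_def)

lemma lambda_s_bounds:
  assumes "0 < \<delta>" "\<delta> \<le> \<delta>0"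
  shows "lambda_s a \<sigma> \<delta> \<le> 0" "\<bar>lambda_s a \<sigma> \<delta>\<bar> \<le> 2 * a * \<sigma>\<^sup>2"
proof -
  have r: "0 < disc_root \<delta>" using disc_root_bounds[OF assms] by simp
  have "0 \<le> 2 * a * \<sigma>\<^sup>2 / (1 + disc_root \<delta>)"
    using r a_pos by simp
  moreover have "2 * a * \<sigma>\<^sup>2 / (1 + disc_root \<delta>) \<le> 2 * a * \<sigma>\<^sup>2"
    using r a_pos by (simp add: pos_divide_le_eq algebra_simps)
  ultimately show "lambda_s a \<sigma> \<delta> \<le> 0" "\<bar>lambda_s a \<sigma> \<delta>\<bar> \<le> 2 * a * \<sigma>\<^sup>2"
    by (simp_all add: lambda_s_eq[OF assms] del: abs_divide)
qed

lemma lambda_f_bounds: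
  assumes "0 < \<delta>" "\<delta> \<le> \<delta>0"
  shows "lambda_f a \<sigma> \<delta> < 0" "\<bar>lambda_f a \<sigma> \<delta>\<bar> \<le> 1 / \<delta>"
  using disc_root_bounds[OF assms] assms(1) by (simp_all add: lambda_f_eq field_simps)

text \<open>The \<delta>-free factor of \<open>fast_amplitude_eq\<close> at its worst: the slow
  eigenvalue over \<sigma> is at most 2 * a * \<sigma> in modulus, and \<open>disc_root\<close> is
  at least its value at \<open>\<delta>0\<close>.\<close>

definition amplitude_bound :: "real \<Rightarrow> real \<Rightarrow> real" where
  "amplitude_bound u0 q0 = (2 * a * \<sigma> * \<bar>u0\<bar> + \<bar>q0\<bar>) * \<sigma> / disc_root \<delta>0"

section \<open>Amplitudes and errors of the two modes for fixed \<delta>\<close>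

context
  fixes \<delta> u0 q0 bs bf :: real
  assumes delta: "0 < \<delta>" "\<delta> \<le> \<delta>0"
    and U0: "vector [u0, q0] = bs *\<^sub>R v_s a \<sigma> \<delta> + bf *\<^sub>R v_f a \<sigma> \<delta>"
begin

lemma sum_amplitudes: "u0 = bs + bf"
  using arg_cong[OF U0, of "\<lambda>v. v $ 1"] by (simp add: v_s_def v_f_def)

text \<open>Eliminating \<open>bs\<close> leaves \<open>bf\<close> times the eigenvalue gap over
  \<sigma>. The gap is \<open>disc_root \<delta> / \<delta>\<close>, hence the explicit factor
  \<delta>.\<close>

lemma fast_amplitude_eq: "bf = (lambda_s a \<sigma> \<delta> / \<sigma> * u0 - q0) * \<sigma> / disc_root \<delta> * \<delta>"
proof -
  have "q0 = bs * (lambda_s a \<sigma> \<delta> / \<sigma>) + bf * (lambda_f a \<sigma> \<delta> / \<sigma>)"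
    using arg_cong[OF U0, of "\<lambda>v. v $ 2"] by (simp add: v_s_def v_f_def)
  then have "lambda_s a \<sigma> \<delta> / \<sigma> * u0 - q0 = bf * ((lambda_s a \<sigma> \<delta> - lambda_f a \<sigma> \<delta>) / \<sigma>)"
    by (simp add: sum_amplitudes add_divide_distrib diff_divide_distrib algebra_simps)
  also have "lambda_s a \<sigma> \<delta> - lambda_f a \<sigma> \<delta> = disc_root \<delta> / \<delta>"
    using delta by (simp add: lambda_s_def lambda_f_def disc_root_def field_simps)
  finally show ?thesis
    using delta sigma_pos disc_root_bounds[OF delta] by (simp add: field_simps)
qed

lemma fast_amplitude_le: "\<bar>bf\<bar> \<le> amplitude_bound u0 q0 * \<delta>"
proof -
  have "\<bar>lambda_s a \<sigma> \<delta> / \<sigma>\<bar> \<le> 2 * a * \<sigma>"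
    using lambda_s_bounds(2)[OF delta] sigma_pos unfolding abs_divide
    by (simp add: pos_divide_le_eq power2_eq_square mult.assoc)
  then have "\<bar>lambda_s a \<sigma> \<delta> / \<sigma>\<bar> * \<bar>u0\<bar> \<le> 2 * a * \<sigma> * \<bar>u0\<bar>"
    by (intro mult_right_mono) auto
  then have "\<bar>lambda_s a \<sigma> \<delta> / \<sigma> * u0 - q0\<bar> \<le> 2 * a * \<sigma> * \<bar>u0\<bar> + \<bar>q0\<bar>"
    using abs_triangle_ineq4[of "lambda_s a \<sigma> \<delta> / \<sigma> * u0" q0] unfolding abs_mult by linarith
  then have "\<bar>lambda_s a \<sigma> \<delta> / \<sigma> * u0 - q0\<bar> * \<sigma> / disc_root \<delta> \<le> amplitude_bound u0 q0"
    unfolding amplitude_bound_def using sigma_pos a_pos disc_root0_pos disc_root_bounds[OF delta]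
    by (intro frac_le mult_right_mono) auto
  from mult_right_mono[OF this, of \<delta>] show ?thesis
    using delta sigma_pos disc_root_bounds[OF delta] by (subst fast_amplitude_eq) (simp add: abs_mult)
qed

text \<open>The stiff rate, at most 1/\<delta>, is cancelled by an amplitude of order
  \<delta>.\<close>

lemma fast_product_le: "\<bar>bf * lambda_f a \<sigma> \<delta>\<bar> \<le> amplitude_bound u0 q0"
proof -
  have "\<bar>bf * lambda_f a \<sigma> \<delta>\<bar> \<le> (amplitude_bound u0 q0 * \<delta>) * (1 / \<delta>)"
    unfolding abs_mult using lambda_f_bounds[OF delta] order.trans[OF abs_ge_zero fast_amplitude_le]
    by (intro mult_mono fast_amplitude_le) auto
  then show ?thesis using delta by simp
qed

lemma slow_product_le:
  "\<bar>bs * lambda_s a \<sigma> \<delta>\<bar> \<le> (\<bar>u0\<bar> + amplitude_bound u0 q0 * \<delta>0) * (2 * a * \<sigma>\<^sup>2)"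
proof -
  have "0 \<le> amplitude_bound u0 q0"
    using sigma_pos a_pos disc_root0_pos by (simp add: amplitude_bound_def)
  then have "amplitude_bound u0 q0 * \<delta> \<le> amplitude_bound u0 q0 * \<delta>0"
    using delta by (intro mult_left_mono) auto
  then have "\<bar>bs\<bar> \<le> \<bar>u0\<bar> + amplitude_bound u0 q0 * \<delta>0"
    using sum_amplitudes fast_amplitude_le by linarith
  then show ?thesis
    unfolding abs_mult using lambda_s_bounds[OF delta] by (intro mult_mono) auto
qed

text \<open>Both propagators act as scalars on \<open>v_s\<close> and \<open>v_f\<close>, so the
  error splits mode by mode.\<close>

lemma error_eq:
  assumes dt: "0 \<le> dt" and C: "0 \<le> C"
  shows "U_num C a \<sigma> \<delta> (vector [u0, q0]) dt n - U_exact a \<sigma> \<delta> (vector [u0, q0]) (real n * dt) =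
    (bs * (R_fun C (dt * lambda_s a \<sigma> \<delta>) ^ n - exp (real n * (dt * lambda_s a \<sigma> \<delta>)))) *\<^sub>R v_s a \<sigma> \<delta> +
    (bf * (R_fun C (dt * lambda_f a \<sigma> \<delta>) ^ n - exp (real n * (dt * lambda_f a \<sigma> \<delta>)))) *\<^sub>R v_f a \<sigma> \<delta>"
proof -
  have "4 * a * \<delta> * \<sigma>\<^sup>2 < 1"
    using disc_root_bounds(2)[OF delta] by (simp add: disc_root_def)
  note eig = B_mat_eigenvectors[OF sigma_pos delta(1) this]
  have span: "\<exists>s t. x = s *\<^sub>R v_s a \<sigma> \<delta> + t *\<^sub>R v_f a \<sigma> \<delta>" for x
    using eigen_decomposition[OF sigma_pos delta(1) \<open>4 * a * \<delta> * \<sigma>\<^sup>2 < 1\<close>, of x] by auto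
  have s: "(t *\<^sub>R B_mat a \<sigma> \<delta>) *v v_s a \<sigma> \<delta> = (t * lambda_s a \<sigma> \<delta>) *\<^sub>R v_s a \<sigma> \<delta>" for t
    by (simp add: scaleR_matrix_vector_assoc[symmetric] eig)
  have f: "(t *\<^sub>R B_mat a \<sigma> \<delta>) *v v_f a \<sigma> \<delta> = (t * lambda_f a \<sigma> \<delta>) *\<^sub>R v_f a \<sigma> \<delta>" for t
    by (simp add: scaleR_matrix_vector_assoc[symmetric] eig)
  have neg: "dt * lambda_s a \<sigma> \<delta> \<le> 0" "dt * lambda_f a \<sigma> \<delta> \<le> 0"
    using dt lambda_s_bounds[OF delta] lambda_f_bounds[OF delta] by (simp_all add: mult_nonneg_nonpos)
  \<comment> \<open>\<open>R_mat_eigen\<close> treats its first eigenvector; the swapped span gives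
    the fast mode.\<close>
  have span': "\<exists>s t. x = s *\<^sub>R v_f a \<sigma> \<delta> + t *\<^sub>R v_s a \<sigma> \<delta>" for x
    using span[of x] by (metis add.commute)
  note R = mat_pow_eigen[OF R_mat_eigen[OF s neg(1) f neg(2) span C]]
    mat_pow_eigen[OF R_mat_eigen[OF f neg(2) s neg(1) span' C]]
  show ?thesis
    unfolding U_num_def U_exact_def U0
    by (simp add: matrix_vector_right_distrib matrix_vector_mult_scaleR R
        mat_exp_eigen[OF s] mat_exp_eigen[OF f] algebra_simps)
qed

text \<open>Both eigenvectors have first component 1, so the fast error is weighted by
  \<open>bf\<close> alone; the factor \<bar>dt * \<lambda>_f\<bar> from
  \<open>R_fun_power_error\<close> completes it to the bounded product.\<close>

lemma u_error_le:
  assumes "0 \<le> dt" "1/78 \<le> C" "C \<le> 1/6"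
  shows "\<bar>U_num C a \<sigma> \<delta> (vector [u0, q0]) dt n $ 1
      - U_exact a \<sigma> \<delta> (vector [u0, q0]) (real n * dt) $ 1\<bar>
    \<le> 4 * ((\<bar>u0\<bar> + amplitude_bound u0 q0 * \<delta>0) * (2 * a * \<sigma>\<^sup>2) + amplitude_bound u0 q0) * dt"
    (is "\<bar>?e\<bar> \<le> _")
proof -
  define es where "es = R_fun C (dt * lambda_s a \<sigma> \<delta>) ^ n - exp (real n * (dt * lambda_s a \<sigma> \<delta>))"
  define ef where "ef = R_fun C (dt * lambda_f a \<sigma> \<delta>) ^ n - exp (real n * (dt * lambda_f a \<sigma> \<delta>))"
  have "0 \<le> C" using assms by simp
  from arg_cong[OF error_eq[OF assms(1) this, of n], of "\<lambda>v. v $ 1"]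
  have e: "?e = bs * es + bf * ef"
    by (simp add: es_def ef_def v_s_def v_f_def)
  have "\<bar>es\<bar> \<le> 4 * \<bar>dt * lambda_s a \<sigma> \<delta>\<bar>"
    unfolding es_def using assms lambda_s_bounds[OF delta]
    by (intro R_fun_power_error) (auto simp: mult_nonneg_nonpos)
  then have 1: "\<bar>bs * es\<bar> \<le> 4 * dt * \<bar>bs * lambda_s a \<sigma> \<delta>\<bar>"
    using mult_left_mono[of "\<bar>es\<bar>" "4 * \<bar>dt * lambda_s a \<sigma> \<delta>\<bar>" "\<bar>bs\<bar>"] assms(1) by (simp add: abs_mult mult_ac)
  have "\<bar>ef\<bar> \<le> 4 * \<bar>dt * lambda_f a \<sigma> \<delta>\<bar>"
    unfolding ef_def using assms lambda_f_bounds[OF delta]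
    by (intro R_fun_power_error) (auto simp: mult_nonneg_nonpos)
  then have 2: "\<bar>bf * ef\<bar> \<le> 4 * dt * \<bar>bf * lambda_f a \<sigma> \<delta>\<bar>"
    using mult_left_mono[of "\<bar>ef\<bar>" "4 * \<bar>dt * lambda_f a \<sigma> \<delta>\<bar>" "\<bar>bf\<bar>"] assms(1) by (simp add: abs_mult mult_ac)
  have "\<bar>?e\<bar> \<le> 4 * dt * (\<bar>bs * lambda_s a \<sigma> \<delta>\<bar> + \<bar>bf * lambda_f a \<sigma> \<delta>\<bar>)"
    using abs_triangle_ineq[of "bs * es" "bf * ef"] 1 2 unfolding e distrib_left by linarith
  also have "\<dots> \<le> 4 * dt * ((\<bar>u0\<bar> + amplitude_bound u0 q0 * \<delta>0) * (2 * a * \<sigma>\<^sup>2) + amplitude_bound u0 q0)"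
    using assms by (intro mult_left_mono add_mono slow_product_le fast_product_le) auto
  finally show ?thesis by (simp add: mult_ac)
qed

text \<open>Read off the flux component and subtract the slow contribution, which is of order dt.
  The factor \<open>8 * a * \<sigma>\<^sup>2\<close> is 4 from \<open>R_fun_power_error\<close>
  times the bound on the slow eigenvalue.\<close>

lemma one_step_error_ge:
  assumes "0 \<le> dt" "1/78 \<le> C" "C \<le> 1/6"
  shows "\<bar>lambda_f a \<sigma> \<delta> / \<sigma> * bf\<bar> * \<bar>R_fun C (dt * lambda_f a \<sigma> \<delta>) - exp (dt * lambda_f a \<sigma> \<delta>)\<bar>
      - (\<bar>u0\<bar> + amplitude_bound u0 q0 * \<delta>0) * (2 * a * \<sigma>\<^sup>2) / \<sigma> * (8 * a * \<sigma>\<^sup>2) * dt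
    \<le> norm (U_num C a \<sigma> \<delta> (vector [u0, q0]) dt 1 - U_exact a \<sigma> \<delta> (vector [u0, q0]) (real 1 * dt))"
    (is "?l \<le> norm ?e")
proof -
  define es where "es = R_fun C (dt * lambda_s a \<sigma> \<delta>) - exp (dt * lambda_s a \<sigma> \<delta>)"
  define ef where "ef = R_fun C (dt * lambda_f a \<sigma> \<delta>) - exp (dt * lambda_f a \<sigma> \<delta>)"
  have "0 \<le> C" using assms by simp
  from arg_cong[OF error_eq[OF assms(1) this, of 1], of "\<lambda>v. v $ 2"]
  have e: "?e $ 2 = (bs * lambda_s a \<sigma> \<delta>) / \<sigma> * es + lambda_f a \<sigma> \<delta> / \<sigma> * bf * ef"
    by (simp add: es_def ef_def v_s_def v_f_def mult_ac)
  have "\<bar>es\<bar> \<le> 4 * \<bar>dt * lambda_s a \<sigma> \<delta>\<bar>"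
    using R_fun_power_error[of "dt * lambda_s a \<sigma> \<delta>" C 1] assms lambda_s_bounds[OF delta]
    by (simp add: es_def mult_nonneg_nonpos)
  also have "\<dots> \<le> 4 * (dt * (2 * a * \<sigma>\<^sup>2))"
    unfolding abs_mult using assms(1) lambda_s_bounds[OF delta]
    by (intro mult_left_mono mult_mono) auto
  finally have es: "\<bar>es\<bar> \<le> 8 * a * \<sigma>\<^sup>2 * dt" by (simp add: mult_ac)
  have bs: "\<bar>(bs * lambda_s a \<sigma> \<delta>) / \<sigma>\<bar> \<le> (\<bar>u0\<bar> + amplitude_bound u0 q0 * \<delta>0) * (2 * a * \<sigma>\<^sup>2) / \<sigma>"
    unfolding abs_divide using slow_product_le sigma_pos by (simp add: divide_right_mono)
  have "\<bar>(bs * lambda_s a \<sigma> \<delta>) / \<sigma> * es\<bar>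
      \<le> (\<bar>u0\<bar> + amplitude_bound u0 q0 * \<delta>0) * (2 * a * \<sigma>\<^sup>2) / \<sigma> * (8 * a * \<sigma>\<^sup>2 * dt)"
    unfolding abs_mult[of _ es]
    by (rule mult_mono[OF bs es order.trans[OF abs_ge_zero bs] abs_ge_zero])
  moreover have "\<bar>y\<bar> - b \<le> \<bar>x + y\<bar>" if "\<bar>x\<bar> \<le> b" for x y b :: real
    using that by linarith
  ultimately have "?l \<le> \<bar>?e $ 2\<bar>"
    unfolding e ef_def[symmetric] abs_mult[of "lambda_f a \<sigma> \<delta> / \<sigma> * bf", symmetric] mult.assoc
    by blast
  then show ?thesis
    using component_le_norm_cart[of ?e 2] by linarith
qed

end

section \<open>Limits as \<delta> tends to 0\<close>

lemma eventually_delta: "eventually (\<lambda>\<delta>. 0 < \<delta> \<and> \<delta> \<le> \<delta>0) (at_right 0)"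
  using eventually_at_right_less[of 0] eventually_at_right_real[OF delta0_pos]
  by eventually_elim auto

lemma tendsto_disc_root: "(disc_root \<longlongrightarrow> 1) (at_right 0)"
proof -
  have "((\<lambda>\<delta>. sqrt (1 - 4 * a * \<delta> * \<sigma>\<^sup>2)) \<longlongrightarrow> sqrt (1 - 4 * a * 0 * \<sigma>\<^sup>2)) (at_right 0)"
    by (intro tendsto_intros)
  then show ?thesis unfolding disc_root_def by simp
qed

lemma tendsto_lambda_s: "(lambda_s a \<sigma> \<longlongrightarrow> - (a * \<sigma>\<^sup>2)) (at_right 0)"
proof -
  have "((\<lambda>\<delta>. - (2 * a * \<sigma>\<^sup>2 / (1 + disc_root \<delta>))) \<longlongrightarrow> - (2 * a * \<sigma>\<^sup>2 / (1 + 1))) (at_right 0)"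
    by (intro tendsto_intros tendsto_disc_root) simp
  moreover have "eventually (\<lambda>\<delta>. - (2 * a * \<sigma>\<^sup>2 / (1 + disc_root \<delta>)) = lambda_s a \<sigma> \<delta>) (at_right 0)"
    using eventually_delta by eventually_elim (simp add: lambda_s_eq)
  ultimately show ?thesis by (simp add: tendsto_cong)
qed

text \<open>In the product of the explicit formulas for the fast eigenvalue and amplitude \<delta>
  cancels. The limit is m_0, so the fast flux does not fade when m_0 is nonzero.\<close>

lemma tendsto_fast_flux:
  assumes U0: "\<And>\<delta>. 0 < \<delta> \<Longrightarrow> \<delta> \<le> \<delta>0 \<Longrightarrow>
      vector [u0, q0] = \<beta>s \<delta> *\<^sub>R v_s a \<sigma> \<delta> + \<beta>f \<delta> *\<^sub>R v_f a \<sigma> \<delta>"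
  shows "((\<lambda>\<delta>. lambda_f a \<sigma> \<delta> / \<sigma> * \<beta>f \<delta>) \<longlongrightarrow> q0 + a * \<sigma> * u0) (at_right 0)"
proof -
  have "((\<lambda>\<delta>. (q0 - lambda_s a \<sigma> \<delta> / \<sigma> * u0) * ((1 + disc_root \<delta>) / (2 * disc_root \<delta>))) \<longlongrightarrow>
      (q0 - - (a * \<sigma>\<^sup>2) / \<sigma> * u0) * ((1 + 1) / (2 * 1))) (at_right 0)"
    using sigma_pos by (intro tendsto_intros tendsto_disc_root tendsto_lambda_s) auto
  moreover have "eventually (\<lambda>\<delta>. (q0 - lambda_s a \<sigma> \<delta> / \<sigma> * u0) * ((1 + disc_root \<delta>) / (2 * disc_root \<delta>)) =
      lambda_f a \<sigma> \<delta> / \<sigma> * \<beta>f \<delta>) (at_right 0)"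
    using eventually_delta
  proof eventually_elim
    case (elim \<delta>)
    then have d: "0 < \<delta>" "\<delta> \<le> \<delta>0" by auto
    show ?case
      unfolding fast_amplitude_eq[OF d U0[OF d]] lambda_f_eq
      using d sigma_pos disc_root_bounds[OF d] by (simp add: field_simps)
  qed
  ultimately show ?thesis
    using sigma_pos by (simp add: tendsto_cong power2_eq_square)
qed

text \<open>This step size pins dt * \<lambda>_f at -1/\<kappa>. Its approach to 0 through positive
  values turns a limit in dt into one in \<delta>.\<close>

lemma filterlim_step:
  assumes "0 < \<kappa>"
  shows "filterlim (\<lambda>\<delta>. - 1 / (\<kappa> * lambda_f a \<sigma> \<delta>)) (at_right 0) (at_right 0)"
proof -
  have "((\<lambda>\<delta>. 2 * \<delta> / (\<kappa> * (1 + disc_root \<delta>))) \<longlongrightarrow> 2 * 0 / (\<kappa> * (1 + 1))) (at_right 0)"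
    using assms by (intro tendsto_intros tendsto_disc_root) auto
  moreover have "- 1 / (\<kappa> * lambda_f a \<sigma> \<delta>) = 2 * \<delta> / (\<kappa> * (1 + disc_root \<delta>))" for \<delta>
    by (simp add: lambda_f_eq minus_divide_right[symmetric] del: minus_add_distrib)
  ultimately have "((\<lambda>\<delta>. - 1 / (\<kappa> * lambda_f a \<sigma> \<delta>)) \<longlongrightarrow> 0) (at_right 0)"
    by simp
  moreover have "eventually (\<lambda>\<delta>. - 1 / (\<kappa> * lambda_f a \<sigma> \<delta>) > 0) (at_right 0)"
    using eventually_delta
    by eventually_elim (use assms lambda_f_bounds in \<open>auto simp: divide_neg_neg mult_pos_neg\<close>)
  ultimately show ?thesis by (rule tendsto_imp_filterlim_at_right)
qed

end

section \<open>The uniform errors\<close>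

lemma finite_time_steps:
  assumes "0 < dt"
  shows "finite {n. real n * dt \<le> T}"
proof (rule finite_subset)
  show "{n. real n * dt \<le> T} \<subseteq> {..nat \<lceil>T / dt\<rceil>}"
  proof
    fix n assume "n \<in> {n. real n * dt \<le> T}"
    then have "real n \<le> T / dt" using assms by (simp add: field_simps)
    then show "n \<in> {..nat \<lceil>T / dt\<rceil>}" by (simp, linarith)
  qed
qed simp

theorem proposition7:
  fixes a \<sigma> \<delta>0 C T u0 q0 :: real
    and U0 :: "real^2"
    and \<beta>s \<beta>f :: "real \<Rightarrow> real"
  assumes "a > 0" and "\<sigma> > 0" and "\<delta>0 > 0" and "4 * a * \<delta>0 * \<sigma>\<^sup>2 < 1"
    and "C \<in> {C_minus..C_plus}" and "T > 0"
    and "U0 = vector [u0, q0]"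
    and "q0 + a * \<sigma> * u0 \<noteq> 0"
    and "\<And>\<delta>. 0 < \<delta> \<Longrightarrow> \<delta> \<le> \<delta>0 \<Longrightarrow> U0 = \<beta>s \<delta> *\<^sub>R v_s a \<sigma> \<delta> + \<beta>f \<delta> *\<^sub>R v_f a \<sigma> \<delta>"
  shows "\<beta>f \<in> O[at_right 0](\<lambda>\<delta>. \<delta>)
    \<and> (\<lambda>\<delta>. lambda_f a \<sigma> \<delta> / \<sigma> * \<beta>f \<delta>) \<in> O[at_right 0](\<lambda>\<delta>. 1)
    \<and> ((\<exists>\<kappa>>0. R_fun C (- 1 / \<kappa>) \<noteq> exp (- 1 / \<kappa>)) \<longrightarrow>
         \<not> (full_error C a \<sigma> \<delta>0 T U0 \<longlongrightarrow> 0) (at_right 0))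
    \<and> (\<exists>K::real. \<forall>\<Delta>t>0. u_error C a \<sigma> \<delta>0 T U0 \<Delta>t \<le> ereal (K * \<Delta>t))"
proof -
  interpret coupled_mode a \<sigma> \<delta>0
    using assms by unfold_locales
  have U0: "vector [u0, q0] = \<beta>s \<delta> *\<^sub>R v_s a \<sigma> \<delta> + \<beta>f \<delta> *\<^sub>R v_f a \<sigma> \<delta>" if "0 < \<delta>" "\<delta> \<le> \<delta>0" for \<delta>
    using assms(9)[OF that] assms(7) by simp
  note C = C_range[OF assms(5)]
  have fast: "\<beta>f \<in> O[at_right 0](\<lambda>\<delta>. \<delta>)"
  proof (rule bigoI)
    show "eventually (\<lambda>\<delta>. norm (\<beta>f \<delta>) \<le> amplitude_bound u0 q0 * norm \<delta>) (at_right 0)"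
      using eventually_delta by eventually_elim (use fast_amplitude_le[OF _ _ U0] in auto)
  qed
  have flux: "(\<lambda>\<delta>. lambda_f a \<sigma> \<delta> / \<sigma> * \<beta>f \<delta>) \<in> O[at_right 0](\<lambda>\<delta>. 1)"
    by (rule bigoI_tendsto[where c = "q0 + a * \<sigma> * u0"]) (use tendsto_fast_flux[OF U0] in auto)
  have full: "\<not> (full_error C a \<sigma> \<delta>0 T U0 \<longlongrightarrow> 0) (at_right 0)"
    if \<kappa>: "0 < \<kappa>" and ne: "R_fun C (- 1 / \<kappa>) \<noteq> exp (- 1 / \<kappa>)" for \<kappa>
  proof
    assume lim: "(full_error C a \<sigma> \<delta>0 T U0 \<longlongrightarrow> 0) (at_right 0)"
    define dt where "dt \<delta> = - 1 / (\<kappa> * lambda_f a \<sigma> \<delta>)" for \<delta>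
    have dt: "filterlim dt (at_right 0) (at_right 0)"
      using filterlim_step[OF \<kappa>] by (simp add: dt_def[abs_def])
    then have dt0: "(dt \<longlongrightarrow> 0) (at_right 0)" and dt_pos: "eventually (\<lambda>\<delta>. 0 < dt \<delta>) (at_right 0)"
      by (auto simp: filterlim_at elim: eventually_mono)
    \<comment> \<open>\<open>L\<close> is the lower bound of \<open>one_step_error_ge\<close> along
      this coupling of step and \<delta>. Its limit \<open>c\<close> is positive since m_0 is
      nonzero and R differs from exp at -1/\<kappa>.\<close>
    define L where "L \<delta> = \<bar>lambda_f a \<sigma> \<delta> / \<sigma> * \<beta>f \<delta>\<bar> * \<bar>R_fun C (- 1 / \<kappa>) - exp (- 1 / \<kappa>)\<bar>
      - (\<bar>u0\<bar> + amplitude_bound u0 q0 * \<delta>0) * (2 * a * \<sigma>\<^sup>2) / \<sigma> * (8 * a * \<sigma>\<^sup>2) * dt \<delta>" for \<delta>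
    define c where "c = \<bar>q0 + a * \<sigma> * u0\<bar> * \<bar>R_fun C (- 1 / \<kappa>) - exp (- 1 / \<kappa>)\<bar>"
    have c: "0 < c" using assms(8) ne by (simp add: c_def)
    have "(L \<longlongrightarrow> c - (\<bar>u0\<bar> + amplitude_bound u0 q0 * \<delta>0) * (2 * a * \<sigma>\<^sup>2) / \<sigma> * (8 * a * \<sigma>\<^sup>2) * 0) (at_right 0)"
      unfolding L_def[abs_def] c_def by (intro tendsto_intros tendsto_fast_flux[OF U0] dt0) auto
    then have L: "eventually (\<lambda>\<delta>. c / 2 < L \<delta>) (at_right 0)"
      using c by (intro order_tendstoD(1)) auto
    have "eventually (\<lambda>\<delta>. full_error C a \<sigma> \<delta>0 T U0 (dt \<delta>) < ereal (c / 2)) (at_right 0)"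
      using filterlim_compose[OF lim dt] c by (intro order_tendstoD(2)) auto
    \<comment> \<open>Makes n = 1 an admissible time index.\<close>
    moreover have "eventually (\<lambda>\<delta>. dt \<delta> < T) (at_right 0)"
      using dt0 assms(6) by (rule order_tendstoD)
    \<comment> \<open>The filter is nontrivial, so one small \<delta> with \<open>L \<delta>\<close>
      both above and below c/2 is a contradiction.\<close>
    ultimately have "eventually (\<lambda>\<delta>::real. False) (at_right 0)"
      using L dt_pos eventually_delta
    proof eventually_elim
      case (elim \<delta>)
      then have d: "0 < \<delta>" "\<delta> \<le> \<delta>0" by auto
      let ?e = "\<lambda>n. norm (U_num C a \<sigma> \<delta> U0 (dt \<delta>) n - U_exact a \<sigma> \<delta> U0 (real n * dt \<delta>))"
      have z: "dt \<delta> * lambda_f a \<sigma> \<delta> = - 1 / \<kappa>"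
        using lambda_f_bounds[OF d] by (simp add: dt_def)
      have "L \<delta> \<le> ?e 1"
        using one_step_error_ge[OF d U0[OF d], of "dt \<delta>" C] elim C unfolding z L_def assms(7) by simp
      also have "\<dots> \<le> Max (?e ` {n. real n * dt \<delta> \<le> T})"
        using elim by (intro Max_ge finite_imageI finite_time_steps imageI) auto
      finally have "ereal (L \<delta>) \<le> full_error C a \<sigma> \<delta>0 T U0 (dt \<delta>)"
        unfolding full_error_def using d by (intro SUP_upper2[of \<delta>]) auto
      then have "ereal (L \<delta>) < ereal (c / 2)" using elim by (metis order.strict_trans1)
      then show False using elim by simp
    qed
    then show False by simp
  qed
  define K where
    "K = 4 * ((\<bar>u0\<bar> + amplitude_bound u0 q0 * \<delta>0) * (2 * a * \<sigma>\<^sup>2) + amplitude_bound u0 q0)"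
  have "u_error C a \<sigma> \<delta>0 T U0 dt \<le> ereal (K * dt)" if dt: "0 < dt" for dt
    unfolding u_error_def
  proof (rule SUP_least)
    fix \<delta> assume "\<delta> \<in> {0<..\<delta>0}"
    then have d: "0 < \<delta>" "\<delta> \<le> \<delta>0" by auto
    \<comment> \<open>Index 0 keeps the set nonempty even when dt exceeds T, so that
      \<open>Max\<close> is a genuine maximum.\<close>
    have "0 \<in> {n. real n * dt \<le> T}" using assms(6) by simp
    then have "{n. real n * dt \<le> T} \<noteq> {}" by blast
    then show "ereal (Max ((\<lambda>n. \<bar>U_num C a \<sigma> \<delta> U0 dt n $ 1 - U_exact a \<sigma> \<delta> U0 (real n * dt) $ 1\<bar>)
        ` {n. real n * dt \<le> T})) \<le> ereal (K * dt)"
      using u_error_le[OF d U0[OF d] less_imp_le[OF dt] C] finite_time_steps[OF dt]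
      unfolding assms(7) K_def by simp
  qed
  then show ?thesis using fast flux full by blast
qed

end
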